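(* Let $k\ge 2$ and $n\ge 1$ be integers, and write $\mathcal S=\mathcal S_{k,n}$. If $\mathbf p\in\mathcal P_k$ is any permutation of $\mathbf p_0=(1,0,\dots,0)$, then $$\sum_{\mathbf x\in\mathcal S}\left|\left\{\mathbf y\in\mathcal S: \binom{n}{\mathbf x}\le\binom{n}{\mathbf y}\right\}\right| f_{\mathrm{ecp}}(\mathbf x)\;>\;\sum_{\mathbf x\in\mathcal S}\left|\left\{\mathbf y\in\mathcal S: f_{\mathbf p}(\mathbf x)\le f_{\mathbf p}(\mathbf y)\right\}\right| f_{\mathbf p}(\mathbf x).$$
   Context: Let $\mathcal S_{k,n}=\{\mathbf x=(x_1,\dots,x_k): x_j\in\mathbb Z_{\ge 0},\ \sum_{j=1}^k x_j=n\}$ and $\mathcal P_k=\{\mathbf p=(p_1,\dots,p_k): 0\le p_j\le 1,\ \sum_{j=1}^k p_j=1\}$. Write $\binom{n}{\mathbf x}=\frac{n!}{\prod_{j=1}^k x_j!}$. For $\mathbf p\in\mathcal P_k$ the multinomial pmf is $f_{\mathbf p}(\mathbf x)=\binom{n}{\mathbf x}\prod_{j=1}^k p_j^{x_j}$ for $\mathbf x\in\mathcal S_{k,n}$ (with $0^0=1$), and $f_{\mathrm{ecp}}(\mathbf x)=\binom{n}{\mathbf x}k^{-n}$ is the pmf for $\mathbf p=(1/k,\dots,1/k)$. $|A|$ denotes the number of elements of a finite set $A$. *)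

theory Defs
  imports Complex_Main "HOL-Library.FuncSet" "HOL-Combinatorics.Permutations"
begin

text \<open>A \<open>k\<close>-tuple is a function on \<open>{1..k}\<close>, extensional (\<open>undefined\<close> elsewhere), so that equality
  and cardinality of sets of tuples have their usual meaning.\<close>

definition count_vectors :: "nat \<Rightarrow> nat \<Rightarrow> (nat \<Rightarrow> nat) set" where
  "count_vectors k n = {x \<in> {1..k} \<rightarrow>\<^sub>E UNIV. (\<Sum>j=1..k. x j) = n}"

definition prob_vectors :: "nat \<Rightarrow> (nat \<Rightarrow> real) set" where
  "prob_vectors k = {p \<in> {1..k} \<rightarrow>\<^sub>E {0..1}. (\<Sum>j=1..k. p j) = 1}"

definition multinomial_coeff :: "nat \<Rightarrow> nat \<Rightarrow> (nat \<Rightarrow> nat) \<Rightarrow> real" where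
  "multinomial_coeff k n x = fact n / (\<Prod>j=1..k. fact (x j))"

definition multinomial_prob :: "nat \<Rightarrow> nat \<Rightarrow> (nat \<Rightarrow> real) \<Rightarrow> (nat \<Rightarrow> nat) \<Rightarrow> real" where
  "multinomial_prob k n p x = multinomial_coeff k n x * (\<Prod>j=1..k. p j ^ x j)"

definition uniform_vector :: "nat \<Rightarrow> nat \<Rightarrow> real" where
  "uniform_vector k = (\<lambda>j\<in>{1..k}. 1 / real k)"

definition ecp_prob :: "nat \<Rightarrow> nat \<Rightarrow> (nat \<Rightarrow> nat) \<Rightarrow> real" where
  "ecp_prob k n = multinomial_prob k n (uniform_vector k)"

lemma ecp_prob_eq:
  assumes "x \<in> count_vectors k n"
  shows "ecp_prob k n x = multinomial_coeff k n x / real k ^ n"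
proof -
  have "(\<Prod>j=1..k. uniform_vector k j ^ x j) = (\<Prod>j=1..k. (1 / real k) ^ x j)"
    by (intro prod.cong) (auto simp: uniform_vector_def)
  also have "\<dots> = (1 / real k) ^ n"
    using assms by (simp add: count_vectors_def flip: power_sum)
  finally show ?thesis
    by (simp add: ecp_prob_def multinomial_prob_def power_divide)
qed

definition unit_vector :: "nat \<Rightarrow> nat \<Rightarrow> real" where
  "unit_vector k = (\<lambda>j\<in>{1..k}. if j = 1 then 1 else 0)"

text \<open>Since \<open>\<pi> permutes {1..k}\<close> fixes every index outside \<open>{1..k}\<close>, the rearranged tuple is again
  extensional.\<close>

definition is_rearrangement :: "nat \<Rightarrow> (nat \<Rightarrow> 'a) \<Rightarrow> (nat \<Rightarrow> 'a) \<Rightarrow> bool" where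
  "is_rearrangement k p q \<longleftrightarrow> (\<exists>\<pi>. \<pi> permutes {1..k} \<and> p = q \<circ> \<pi>)"

end

(* For a degenerate p the multinomial distribution is concentrated at one point, whose rank is 1, so
   the right-hand side is the total mass 1 of f_p. On the left every rank is at least 1, so the sum is at
   least the total mass 1 of f_ecp; it is larger because the vectors (n,0,...,0) and (0,n,0,...,0) have
   the same multinomial coefficient and positive mass, so the first has rank at least 2. *)

theory Submission
  imports Defs
begin

lemma finite_count_vectors: "finite (count_vectors k n)"
proof (rule finite_subset)
  show "count_vectors k n \<subseteq> {1..k} \<rightarrow>\<^sub>E {..n}"
  proof
    fix x assume x: "x \<in> count_vectors k n"
    have "x j \<le> n" if "j \<in> {1..k}" for j
      using x member_le_sum[of j "{1..k}" x] that by (auto simp: count_vectors_def)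
    with x show "x \<in> {1..k} \<rightarrow>\<^sub>E {..n}"
      by (auto simp: count_vectors_def PiE_iff)
  qed
qed (simp add: finite_PiE)

text \<open>Splitting off the last entry \<open>m\<close> is what makes induction on
  \<open>k\<close> possible. The inverse bijection resets position \<open>Suc k\<close> to
  \<open>undefined\<close>, since the shorter tuple must again be extensional.\<close>

lemma sum_count_vectors_Suc:
  "(\<Sum>x\<in>count_vectors (Suc k) n. h x) =
   (\<Sum>m\<le>n. \<Sum>y\<in>count_vectors k (n - m). h (y(Suc k := m)))"
proof -
  have upd: "(\<Sum>j=1..k. (f(Suc k := m)) j) = sum f {1..k}" for f :: "nat \<Rightarrow> nat" and m
    by (rule sum.cong) auto
  have "(\<Sum>x\<in>count_vectors (Suc k) n. h x) =
        (\<Sum>(m, y)\<in>(SIGMA m:{..n}. count_vectors k (n - m)). h (y(Suc k := m)))"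
    by (rule sum.reindex_bij_witness[where
          i = "\<lambda>(m, y). y(Suc k := m)" and j = "\<lambda>x. (x (Suc k), x(Suc k := undefined))"])
      (auto simp: count_vectors_def PiE_iff extensional_def upd fun_eq_iff simp del: fun_upd_apply,
       auto simp: le_Suc_eq)
  then show ?thesis
    by (simp add: sum.Sigma finite_count_vectors)
qed

text \<open>The multinomial theorem, by induction on \<open>k\<close> from the binomial theorem. It
  supplies the total mass of both \<open>ecp_prob\<close> and a degenerate
  \<open>multinomial_prob\<close>.\<close>

theorem multinomial:
  "(\<Sum>x\<in>count_vectors k n. multinomial_prob k n p x) = (\<Sum>j=1..k. p j) ^ n"
proof (induction k arbitrary: n)
  case 0
  \<comment> \<open>The empty sum is 0, so only \<open>n = 0\<close> admits a tuple; this matches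
    \<open>0 ^ n\<close> on the right, with \<open>0 ^ 0 = 1\<close>.\<close>
  have "count_vectors 0 n = (if n = 0 then {\<lambda>_. undefined} else {})"
    by (auto simp: count_vectors_def)
  then show ?case
    by (auto simp: multinomial_prob_def multinomial_coeff_def)
next
  case (Suc k)
  \<comment> \<open>The coefficient factors because n!/m! equals \<open>n choose m\<close> times (n
    - m)!, and updating position \<open>Suc k\<close> leaves the products over \<open>{1..k}\<close>
    unchanged.\<close>
  have split: "multinomial_prob (Suc k) n p (y(Suc k := m)) =
      of_nat (n choose m) * p (Suc k) ^ m * multinomial_prob k (n - m) p y"
    if "m \<le> n" for m and y :: "nat \<Rightarrow> nat"
  proof -
    have "(\<Prod>j=1..k. fact ((y(Suc k := m)) j)) = (\<Prod>j=1..k. fact (y j) :: real)"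
      "(\<Prod>j=1..k. p j ^ ((y(Suc k := m)) j)) = (\<Prod>j=1..k. p j ^ y j)"
      by (auto intro: prod.cong)
    with that show ?thesis
      by (simp add: multinomial_prob_def multinomial_coeff_def binomial_fact field_simps
          del: fun_upd_apply) simp
  qed
  have "(\<Sum>x\<in>count_vectors (Suc k) n. multinomial_prob (Suc k) n p x) =
        (\<Sum>m\<le>n. of_nat (n choose m) * p (Suc k) ^ m * (\<Sum>j=1..k. p j) ^ (n - m))"
    by (simp add: sum_count_vectors_Suc split Suc.IH flip: sum_distrib_left)
  also have "\<dots> = (\<Sum>j=1..Suc k. p j) ^ n"
    by (simp add: binomial_ring[symmetric] add.commute)
  finally show ?case .
qed

lemma multinomial_coeff_pos: "multinomial_coeff k n x > 0"
  by (simp add: multinomial_coeff_def prod_pos)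

lemma sum_ecp_prob:
  assumes "k \<ge> 1"
  shows "(\<Sum>x\<in>count_vectors k n. ecp_prob k n x) = 1"
  using assms by (simp add: ecp_prob_def multinomial uniform_vector_def)

lemma ecp_prob_pos:
  assumes "k \<ge> 1" and "x \<in> count_vectors k n"
  shows "ecp_prob k n x > 0"
  using assms by (simp add: ecp_prob_eq multinomial_coeff_pos)

definition concentrated :: "nat \<Rightarrow> nat \<Rightarrow> nat \<Rightarrow> nat \<Rightarrow> nat" where
  "concentrated k n i = (\<lambda>j\<in>{1..k}. if j = i then n else 0)"

lemma concentrated_in_count_vectors:
  assumes "i \<in> {1..k}"
  shows "concentrated k n i \<in> count_vectors k n"
  using assms by (simp add: count_vectors_def concentrated_def)

lemma multinomial_coeff_concentrated:
  assumes "i \<in> {1..k}"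
  shows "multinomial_coeff k n (concentrated k n i) = 1"
proof -
  have "(\<Prod>j=1..k. fact (concentrated k n i j) :: real) = (\<Prod>j=1..k. if j = i then fact n else 1)"
    by (rule prod.cong) (auto simp: concentrated_def)
  also have "\<dots> = fact n"
    using assms by simp
  finally show ?thesis
    by (simp add: multinomial_coeff_def)
qed

text \<open>Any other tuple has a nonzero entry at some \<open>j\<close> distinct from
  \<open>i\<close>, and there \<open>p j ^ x j\<close> is a positive power of 0.\<close>

lemma multinomial_prob_degenerate_eq_0:
  assumes p: "\<And>j. j \<in> {1..k} \<Longrightarrow> p j = (if j = i then 1 else 0)" and i: "i \<in> {1..k}"
    and x: "x \<in> count_vectors k n" "x \<noteq> concentrated k n i"
  shows "multinomial_prob k n p x = 0"
proof -
  have "\<exists>j\<in>{1..k}. j \<noteq> i \<and> x j \<noteq> 0"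
  proof (rule ccontr)
    assume "\<not> ?thesis"
    then have zero: "x j = 0" if "j \<in> {1..k}" "j \<noteq> i" for j
      using that by blast
    have "x i = n"
      using x(1) i sum.remove[of "{1..k}" i x] zero by (simp add: count_vectors_def)
    with zero x(1) have "x = concentrated k n i"
      by (fastforce simp: concentrated_def count_vectors_def PiE_iff extensional_def)
    with x(2) show False by contradiction
  qed
  then obtain j where "j \<in> {1..k}" "p j ^ x j = 0"
    using p by auto
  then have "(\<Prod>j=1..k. p j ^ x j) = 0"
    by (intro prod_zero) auto
  then show ?thesis
    by (simp add: multinomial_prob_def)
qed

text \<open>Each term equals \<open>?f x\<close>: where \<open>?f x\<close> vanishes the rank is
  irrelevant, and at the only possible remaining point the rank is 1. The sum is therefore the total
  mass.\<close>

lemma sum_rank_degenerate: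
  assumes p: "\<And>j. j \<in> {1..k} \<Longrightarrow> p j = (if j = i then 1 else 0)" and i: "i \<in> {1..k}"
  shows "(\<Sum>x\<in>count_vectors k n.
            real (card {y \<in> count_vectors k n. multinomial_prob k n p x \<le> multinomial_prob k n p y})
              * multinomial_prob k n p x) = 1"
proof -
  let ?f = "multinomial_prob k n p"
  let ?S = "count_vectors k n"
  have nonneg: "?f x \<ge> 0" for x
    using p by (auto simp: multinomial_prob_def less_imp_le[OF multinomial_coeff_pos]
        intro!: mult_nonneg_nonneg prod_nonneg)
  have "real (card {y \<in> ?S. ?f x \<le> ?f y}) * ?f x = ?f x" if "x \<in> ?S" for x
  proof (cases "?f x = 0")
    case False
    then have x: "x = concentrated k n i"
      using multinomial_prob_degenerate_eq_0[OF p i] that by blast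
    \<comment> \<open>Here \<open>?f x\<close> is positive, so \<open>?f y\<close> is too, and only
      the tuple concentrated at \<open>i\<close> can carry mass.\<close>
    have "y = x" if "y \<in> ?S" "?f x \<le> ?f y" for y
    proof -
      have "?f y \<noteq> 0"
        using that False nonneg[of x] by linarith
      then show ?thesis
        using multinomial_prob_degenerate_eq_0[OF p i] that x by blast
    qed
    then have "{y \<in> ?S. ?f x \<le> ?f y} = {x}"
      using that by auto
    then show ?thesis by simp
  qed simp
  then have "(\<Sum>x\<in>?S. real (card {y \<in> ?S. ?f x \<le> ?f y}) * ?f x) = (\<Sum>x\<in>?S. ?f x)"
    by (intro sum.cong) auto
  also have "\<dots> = (\<Sum>j=1..k. p j) ^ n"
    by (rule multinomial)
  also have "(\<Sum>j=1..k. p j) = 1"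
    using i by (simp add: p)
  finally show ?thesis by simp
qed

lemma sum_rank_ecp_gt_1:
  assumes "k \<ge> 2" and "n \<ge> 1"
  shows "(\<Sum>x\<in>count_vectors k n.
            real (card {y \<in> count_vectors k n. multinomial_coeff k n x \<le> multinomial_coeff k n y})
              * ecp_prob k n x) > 1"
proof -
  let ?S = "count_vectors k n"
  let ?rank = "\<lambda>x. card {y \<in> ?S. multinomial_coeff k n x \<le> multinomial_coeff k n y}"
  let ?u = "concentrated k n 1" and ?v = "concentrated k n 2"
  have u: "?u \<in> ?S" and v: "?v \<in> ?S"
    using assms by (auto intro: concentrated_in_count_vectors)
  \<comment> \<open>The values are \<open>n\<close> and 0, which differ as \<open>n\<close> is
    positive; index 2 is available because \<open>k\<close> is at least 2.\<close>
  have "?u 1 \<noteq> ?v 1"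
    using assms by (simp add: concentrated_def)
  then have "?u \<noteq> ?v" by metis
  then have "2 = card {?u, ?v}" by simp
  also have "\<dots> \<le> ?rank ?u"
    using assms u v
    by (intro card_mono) (auto simp: finite_count_vectors multinomial_coeff_concentrated)
  finally have rank_u: "?rank ?u \<ge> 2" .
  \<comment> \<open>Every \<open>x\<close> is counted in its own rank.\<close>
  have rank: "?rank x \<ge> 1" if "x \<in> ?S" for x
    using that card_gt_0_iff[of "{y \<in> ?S. multinomial_coeff k n x \<le> multinomial_coeff k n y}"]
    by (auto simp: finite_count_vectors Suc_le_eq)
  have pos: "ecp_prob k n x > 0" if "x \<in> ?S" for x
    using ecp_prob_pos that assms by auto
  have "1 = (\<Sum>x\<in>?S. ecp_prob k n x)"
    using assms by (simp add: sum_ecp_prob)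
  also have "\<dots> < (\<Sum>x\<in>?S. real (?rank x) * ecp_prob k n x)"
  proof (rule sum_strict_mono_ex1)
    show "\<forall>x\<in>?S. ecp_prob k n x \<le> real (?rank x) * ecp_prob k n x"
      using rank less_not_sym[OF pos] by (simp add: mult_le_cancel_right1)
    show "\<exists>x\<in>?S. ecp_prob k n x < real (?rank x) * ecp_prob k n x"
      using rank_u pos[OF u] u by (intro bexI[of _ ?u]) (simp_all add: mult_less_cancel_right1)
  qed (rule finite_count_vectors)
  finally show ?thesis .
qed

theorem proposition3p4:
  fixes k n :: nat and p :: "nat \<Rightarrow> real"
  assumes "k \<ge> 2" and "n \<ge> 1"
    and "p \<in> prob_vectors k"
    and "is_rearrangement k p (unit_vector k)"
  shows "(\<Sum>x\<in>count_vectors k n.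
            real (card {y \<in> count_vectors k n. multinomial_coeff k n x \<le> multinomial_coeff k n y})
              * ecp_prob k n x)
       > (\<Sum>x\<in>count_vectors k n.
            real (card {y \<in> count_vectors k n. multinomial_prob k n p x \<le> multinomial_prob k n p y})
              * multinomial_prob k n p x)"
proof -
  obtain \<pi> where \<pi>: "\<pi> permutes {1..k}" and p: "p = unit_vector k \<circ> \<pi>"
    using assms(4) by (auto simp: is_rearrangement_def)
  \<comment> \<open>The entry 1 of \<open>unit_vector k\<close> sits at index 1, so
    \<open>p j\<close> is 1 exactly when \<open>\<pi> j = 1\<close>.\<close>
  define i where "i = inv \<pi> 1"
  have i: "i \<in> {1..k}"
    using permutes_in_image[OF permutes_inv[OF \<pi>], of 1] assms(1) by (simp add: i_def)
  have "p j = (if j = i then 1 else 0)" if "j \<in> {1..k}" for j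
    using that permutes_in_image[OF \<pi>, of j] permutes_inverses(1)[OF \<pi>, of 1]
      permutes_inverses(2)[OF \<pi>, of j]
    by (auto simp: p i_def unit_vector_def)
  from sum_rank_degenerate[OF this i] sum_rank_ecp_gt_1[OF assms(1,2)] show ?thesis
    by simp
qed

end
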